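(* Let $m\ge 3$ and $n$ be integers with $n\ge\max(2m-1,\frac{m^2}{4}-1)$, and consider tensors $\mathcal F_m\in\mathrm S^m(\mathbb C^{n+1})$ with a decomposition $\mathcal F_m=\sum_{i=1}^r\lambda_i\begin{bmatrix} 1 \\ u_i \end{bmatrix}^{\otimes m}$, $u_i\in\mathbb C^n$. Then the largest rank $r$ of $\mathcal F_m$ that the generating-polynomial incomplete tensor decomposition algorithm can calculate (in the sense given in the context) is $$r_{\max}=\max\left(\binom{k^*}{p^*},\binom{n-2-k^*}{m-1-p^*}\right),$$ where $p^*=\lfloor\frac{m-1}{2}\rfloor$ and $k^*$ is the largest integer $k$ such that $\binom{k}{p^*}\le\binom{n-k-1}{m-p^*-1}$.
   Context: $\mathrm S^m(\mathbb C^{n+1})$ is the space of symmetric tensors of order $m$ over $\mathbb C^{n+1}$. The algorithm recovers the decomposition of $\mathcal F_m$ from its entries with pairwise distinct indices. It uses two integer constants $p$ and $k$ with $1\le p\le m-2$, $p\le k\le n-m+p$: it chooses a set $\mathscr B_0$ of $r$ squarefree monomials of degree $p$ in $x_1,\dots,x_k$, and for each monomial $\alpha=x_{j_1}\cdots x_{j_p}x_{j_{p+1}}$ with $1\le j_1<\dots<j_p\le k<j_{p+1}\le n$ it solves a linear system whose coefficient matrix must have full column rank $r$; its columns are labelled by $\mathscr B_0$, and its rows by the $\binom{n-k-1}{m-p-1}$ squarefree monomials of degree $m-p-1$ in the variables $x_{k+1},\dots,x_n$ other than $x_{j_{p+1}}$. Accordingly, the algorithm requires $\binom{k}{p}\ge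 r$ and $\binom{n-k-1}{m-p-1}\ge r$, and "the algorithm can calculate rank $r$" means that there exist such integers $p\in[1,m-2]$, $k\in[p,n-m+p]$ with $r\le\min\left(\binom{k}{p},\binom{n-k-1}{m-p-1}\right)$. In the definition of $k^*$, $k$ ranges over integers $0\le k\le n-1$; $\binom{a}{b}=0$ for integers $0\le a<b$. *)

theory Defs
  imports Complex_Main
begin

(* The generating-polynomial algorithm for incomplete symmetric tensors of order m over C^(n+1),
   run with the integer constants p and k:
   - it selects r squarefree monomials of degree p in x_1, ..., x_k (there are k choose p of them);
   - each of its linear systems has r columns and must have full column rank r; its rows are
     labelled by the squarefree monomials of degree m - p - 1 in the n - k - 1 variables among
     x_(k+1), ..., x_n other than x_(j_(p+1)).
   "The algorithm can calculate rank r" is the statement that some admissible p and k leave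
   room for r columns and r rows. It depends on the tensor only through m, n and r.
   The ranges p <= m - 2 and k <= n - m + p are written additively, so that no truncated
   subtraction occurs in them; they imply k + 2 <= n and p + 2 <= m, so the subtractions in
   the binomial coefficients are exact. *)
definition can_calculate_rank :: "nat \<Rightarrow> nat \<Rightarrow> nat \<Rightarrow> bool" where
  "can_calculate_rank m n r \<longleftrightarrow>
     (\<exists>p k. 1 \<le> p \<and> p + 2 \<le> m \<and> p \<le> k \<and> k + m \<le> n + p \<and>
            r \<le> min (k choose p) ((n - k - 1) choose (m - p - 1)))"

definition p_star :: "nat \<Rightarrow> nat" where
  "p_star m = (m - 1) div 2"

(* For m >= 3 and n >= 1 the set is finite and contains 0, so Max is a genuine maximum. *)
definition k_star :: "nat \<Rightarrow> nat \<Rightarrow> nat" where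
  "k_star m n =
     Max {k. k \<le> n - 1 \<and> (k choose p_star m) \<le> ((n - k - 1) choose (m - p_star m - 1))}"

(* For m >= 3 and n >= 2m - 1 one has k_star m n + 2 <= n: k = n - 1 fails the defining
   inequality of k_star since (n - 1) choose p_star m > 0 = 0 choose (m - p_star m - 1).
   Hence n - 2 - k_star m n is not truncated. *)
definition r_max :: "nat \<Rightarrow> nat \<Rightarrow> nat" where
  "r_max m n =
     max (k_star m n choose p_star m)
         ((n - 2 - k_star m n) choose (m - 1 - p_star m))"

end

theory Submission
  imports Defs
begin

text \<open>
  Put $t = p^*$, $q = m - 1 - t$ (so $q \in \{t, t+1\}$), $K = k^*$ and $b = n - 2 - K$. Along
  $p = t$, the number $\binom{k}{t}$ grows with $k$ and $\binom{n-k-1}{q}$ falls; they cross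
  between $K$ and $K+1$, so the best value for $p = t$ is
  $R = \max(\binom{K}{t}, \binom{b}{q})$. The question is why no other $p$ does better.
  Exchanging the two binomial coefficients ($p \mapsto m-1-p$, $k \mapsto n-1-k$), it is enough
  to treat $p = t - d$ with $d > 0$. Here it suffices to find one cut $c$ with
  $\binom{c}{t-d} \le R$ and $\binom{n-2-c}{q+d} \le R$: every $k \le c$ is bounded by the first
  coefficient and every $k > c$ by the second. The cut is $c = K + dJ$ for a fixed integer $J$.

  That $J$ need only work at one balanced point. Let $h = \lfloor (n-1)/2 \rfloor$ and suppose
  \[ \binom{h+J}{t-1} \le \binom{h}{t}, \qquad \binom{h-J}{t+1} \le \binom{h}{t}. \]
  The ratio $\binom{x}{v+1} / \binom{x+J}{v}$ increases with $x$ and decreases with $v$. Hence the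
  first inequality persists when $h$ is raised and $t$ lowered, and the second when $h$ is lowered
  and $t$ raised. Since $b \le h \le K$ and $t \le q$, both can be iterated $d$ times starting from
  $\binom{K}{t}$ and $\binom{b}{q}$ (lemmas \<open>lower_bottom_transfer\<close>, \<open>raise_bottom_transfer\<close> and
  \<open>min_binomials_le\<close>).

  The existence of $J$ (lemma \<open>balanced_shift\<close>) is where the size of $n$ enters. For real
  shifts the two inequalities leave an interval of possible values; its length has to be large
  enough to catch an integer, and this is so once $h$ is about $t^2/2$ or more. Take $J$
  maximal for the first inequality, so that $\binom{h+J+1}{t-1} > \binom{h}{t}$; the second
  inequality then follows from
  \[ \binom{h+J+1}{t-1} \binom{h-J}{t+1} \le \binom{h}{t}^2 . \]
  The left side decays at least like $1/(h+2J)$ as $J$ grows, so the crude estimate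
  $J \ge \lfloor (t-1)/3 \rfloor$ is enough to bring it below $\binom{h}{t}^2$.
\<close>

section \<open>Ratios of binomial coefficients\<close>

lemma binomial_raise_top:
  assumes "k \<le> n"
  shows "real (Suc n choose k) * (real n + 1 - real k) = (real n + 1) * real (n choose k)"
proof -
  have "(Suc n - k) * (Suc n choose k) = Suc n * (n choose k)"
    using binomial_absorb_comp[of "Suc n" k] by simp
  then have "real (Suc n - k) * real (Suc n choose k) = real (Suc n) * real (n choose k)"
    by (metis of_nat_mult)
  then show ?thesis
    using assms by (simp add: of_nat_diff algebra_simps)
qed

lemma binomial_raise_bottom:
  assumes "k \<le> n"
  shows "real (n choose Suc k) * (real k + 1) = (real n - real k) * real (n choose k)"
proof -
  have "Suc k * (n choose Suc k) = (n - k) * (n choose k)"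
    using binomial_absorption[of k n] binomial_absorb_comp[of n k] by simp
  then have "real (Suc k) * real (n choose Suc k) = real (n - k) * real (n choose k)"
    by (metis of_nat_mult)
  then show ?thesis
    using assms by (simp add: of_nat_diff algebra_simps)
qed

text \<open>
  Whether $\binom{x+J}{v}$ or $\binom{x}{v+1}$ is larger is read off from the position of this ratio
  relative to $1$. Where $x \le v$ the ratio is $0$, also when its denominator vanishes, so that the
  two monotonicity lemmas hold for all arguments.
\<close>

definition shift_ratio :: "nat \<Rightarrow> nat \<Rightarrow> nat \<Rightarrow> real" where
  "shift_ratio J x v = real (x choose Suc v) / real ((x + J) choose v)"

lemma shift_ratio_mono_top:
  assumes "x \<le> y"
  shows "shift_ratio J x v \<le> shift_ratio J y v"
proof (rule lift_Suc_mono_le[OF _ assms])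
  fix x
  show "shift_ratio J x v \<le> shift_ratio J (Suc x) v"
  proof (cases "Suc v \<le> x")
    case True
    define A where "A = real (x choose Suc v)"
    define B where "B = real ((x + J) choose v)"
    have pos: "A > 0" "B > 0" using True by (auto simp: A_def B_def)
    have a: "real (Suc x choose Suc v) = (real x + 1) * A / (real x - real v)"
      using binomial_raise_top[of "Suc v" x] True by (simp add: A_def field_simps)
    have b: "real ((Suc x + J) choose v)
        = (real x + real J + 1) * B / (real x + real J + 1 - real v)"
      using binomial_raise_top[of v "x + J"] True by (simp add: B_def field_simps)
    have "(real x + real J + 1) * (real x - real v)
        \<le> (real x + 1) * (real x + real J + 1 - real v)"
      by (simp add: algebra_simps)
    then have "1 \<le> (real x + 1) * (real x + real J + 1 - real v)
        / ((real x + real J + 1) * (real x - real v))"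
      using True by (subst le_divide_eq_1_pos) auto
    then have "A / B * 1 \<le> A / B * ((real x + 1) * (real x + real J + 1 - real v)
        / ((real x + real J + 1) * (real x - real v)))"
      using pos by (intro mult_left_mono) auto
    then show ?thesis
      unfolding shift_ratio_def a b A_def[symmetric] B_def[symmetric]
      by (simp add: mult_ac)
  qed (simp add: shift_ratio_def binomial_eq_0)
qed

lemma shift_ratio_antimono_bottom:
  assumes "w \<le> v"
  shows "shift_ratio J x v \<le> shift_ratio J x w"
proof (rule lift_Suc_antimono_le[OF _ assms])
  fix v
  show "shift_ratio J x (Suc v) \<le> shift_ratio J x v"
  proof (cases "Suc (Suc v) \<le> x")
    case True
    define A where "A = real (x choose Suc v)"
    define B where "B = real ((x + J) choose v)"
    have pos: "A > 0" "B > 0" using True by (auto simp: A_def B_def)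
    have a: "real (x choose Suc (Suc v)) = (real x - real v - 1) * A / (real v + 2)"
      using binomial_raise_bottom[of "Suc v" x] True by (simp add: A_def field_simps)
    have b: "real ((x + J) choose Suc v) = (real x + real J - real v) * B / (real v + 1)"
      using binomial_raise_bottom[of v "x + J"] True by (simp add: B_def field_simps)
    have "(real x - real v - 1) * (real v + 1) \<le> (real x + real J - real v) * (real v + 2)"
      using True by (intro mult_mono) auto
    then have "(real x - real v - 1) * (real v + 1)
        / ((real x + real J - real v) * (real v + 2)) \<le> 1"
      using True by (subst divide_le_eq_1_pos) auto
    then have "A / B * ((real x - real v - 1) * (real v + 1)
        / ((real x + real J - real v) * (real v + 2))) \<le> A / B * 1"
      using pos by (intro mult_left_mono) auto
    then show ?thesis
      unfolding shift_ratio_def a b A_def[symmetric] B_def[symmetric]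
      by (simp add: mult_ac)
  qed (simp add: shift_ratio_def binomial_eq_0)
qed

text \<open>
  The ratio is at least $1$ at $(h, u)$, and moving to a larger top and a smaller bottom keeps it so.
\<close>

lemma lower_bottom_transfer:
  assumes "(h + J) choose u \<le> h choose Suc u" and "u < h" and "h \<le> a" and "v \<le> u"
  shows "(a + J) choose v \<le> a choose Suc v"
proof -
  have "1 \<le> shift_ratio J h u"
    using assms(1,2) by (simp add: shift_ratio_def)
  also have "\<dots> \<le> shift_ratio J a u"
    by (rule shift_ratio_mono_top) fact
  also have "\<dots> \<le> shift_ratio J a v"
    by (rule shift_ratio_antimono_bottom) fact
  finally show ?thesis
    using assms by (simp add: shift_ratio_def)
qed

text \<open>
  Seen from $x = h - J$, the hypothesis says that the ratio is at most $1$ at $(x, t)$; moving to a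
  smaller top and a larger bottom keeps it so.
\<close>

lemma raise_bottom_transfer:
  assumes "(h - J) choose Suc t \<le> h choose t" and "b \<le> h" and "t \<le> q"
  shows "(b - J) choose Suc q \<le> b choose q"
proof (cases "J \<le> b \<and> q \<le> b")
  case True
  have "shift_ratio J (b - J) q \<le> shift_ratio J (b - J) t"
    by (rule shift_ratio_antimono_bottom) fact
  also have "\<dots> \<le> shift_ratio J (h - J) t"
    using assms(2) by (intro shift_ratio_mono_top) simp
  also have "\<dots> \<le> 1"
    using assms True by (simp add: shift_ratio_def)
  finally show ?thesis
    using True by (simp add: shift_ratio_def)
qed (auto simp: binomial_eq_0)

section \<open>A shift that works on both sides of a balanced binomial coefficient\<close>

text \<open>
  Each of the $J$ steps divides the coefficient by $1 - u/(h+j)$ for some $j \ge 1$, hence by at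
  least $1 - u/(h+1)$; the product of these is at least $1 - Ju/(h+1)$ by Bernoulli's inequality.
\<close>

lemma binomial_raise_top_upper:
  assumes "u \<le> h"
  shows "real ((h + J) choose u) * (real h + 1 - real J * real u)
    \<le> (real h + 1) * real (h choose u)"
proof (induction J)
  case (Suc J)
  define B where "B = real ((h + J) choose u)"
  define d where "d = real h + real J + 1 - real u"
  have d: "d > 0" using assms by (simp add: d_def)
  have "real ((h + Suc J) choose u) * d = (real h + real J + 1) * B"
    using binomial_raise_top[of u "h + J"] assms by (simp add: B_def d_def)
  then have "real ((h + Suc J) choose u) * (real h + 1 - real (Suc J) * real u) * d
      = B * ((real h + real J + 1) * (real h + 1 - real (Suc J) * real u))"
    by (simp add: mult_ac)
  also have "(real h + real J + 1) * (real h + 1 - real (Suc J) * real u)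
      = (real h + 1 - real J * real u) * d - real J * real u * (1 + real u)"
    by (simp add: d_def algebra_simps)
  also have "B * \<dots> \<le> B * ((real h + 1 - real J * real u) * d)"
    by (intro mult_left_mono) (auto simp: B_def)
  also have "\<dots> \<le> (real h + 1) * real (h choose u) * d"
    using mult_right_mono[OF Suc.IH, of d] d by (simp add: B_def mult_ac)
  finally show ?case
    using d by (simp only: mult_le_cancel_right_pos)
qed simp

text \<open>
  Raising $J$ by one multiplies the product of the two coefficients by at most $1 - 2/h$, and
  $(1 - 2/h)(h + 2J + 2) \le h + 2J$.
\<close>

lemma binomial_product_decay:
  assumes "1 \<le> u"
  shows "real ((h + J + 1) choose u) * real ((h - J) choose (u + 2)) * (real h + 2 * real J)
    \<le> real h * (real ((h + 1) choose u) * real (h choose (u + 2)))"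
proof (induction J)
  case (Suc J)
  show ?case
  proof (cases "u + 2 \<le> h - Suc J")
    case True
    define f where "f = real ((h + J + 1) choose u) * real ((h - J) choose (u + 2))"
    define g where "g = real ((h + Suc J + 1) choose u) * real ((h - Suc J) choose (u + 2))"
    \<comment> \<open>The quotient \<open>g / f\<close> has denominator \<open>c\<close>.\<close>
    define c where "c = (real h + real J + 2 - real u) * (real h - real J)"
    define H K U where "H = real h" and "K = real J" and "U = real u"
    have HK: "H \<ge> K + U + 3" "K \<ge> 0" "U \<ge> 1"
      using True assms by (auto simp: H_def K_def U_def)
    have c: "c > 0" using HK by (auto simp: c_def H_def K_def U_def)
    have f0: "f \<ge> 0" by (simp add: f_def)
    have "real ((h + Suc J + 1) choose u) * (H + K + 2 - U)
        = (H + K + 2) * real ((h + J + 1) choose u)"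
      using binomial_raise_top[of u "h + J + 1"] True
      by (simp add: H_def K_def U_def algebra_simps)
    moreover have "(H - K) * real ((h - Suc J) choose (u + 2))
        = (H - K - U - 2) * real ((h - J) choose (u + 2))"
      using binomial_raise_top[of "u + 2" "h - Suc J"] True
      by (simp add: H_def K_def U_def Suc_diff_Suc of_nat_diff algebra_simps)
    ultimately have "g * c = f * ((H + K + 2) * (H - K - U - 2))"
      unfolding f_def g_def c_def H_def[symmetric] K_def[symmetric] U_def[symmetric]
      by algebra
    then have "H * (g * c) = f * (H * ((H + K + 2) * (H - K - U - 2)))"
      by simp
    also have "\<dots> \<le> f * ((H - 2) * c)"
    proof (intro mult_left_mono f0)
      have "(H + K + 2 - U) * (H - K) \<le> (H + K + 1) * (H - K)"
        using HK by (intro mult_right_mono) auto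
      also have "\<dots> = H * (H + 1) - K * (K + 1)"
        by algebra
      also have "\<dots> \<le> H * (H + 1 + (K + 1) * (U + 1))"
        using HK by (simp add: algebra_simps)
      finally have "2 * ((H + K + 2 - U) * (H - K)) \<le> H * (2 * (H + 1 + (K + 1) * (U + 1)))"
        by linarith
      moreover have "(H + K + 2) * (H - K - U - 2)
          = (H + K + 2 - U) * (H - K) - 2 * (H + 1 + (K + 1) * (U + 1))"
        by algebra
      ultimately show "H * ((H + K + 2) * (H - K - U - 2)) \<le> (H - 2) * c"
        unfolding c_def H_def[symmetric] K_def[symmetric] U_def[symmetric]
        by (simp add: algebra_simps)
    qed
    finally have "(H * g) * c \<le> (f * (H - 2)) * c"
      by (simp add: mult_ac)
    then have step: "H * g \<le> f * (H - 2)"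
      using c by (simp only: mult_le_cancel_right_pos)
    have "H * (g * (H + 2 * (K + 1))) = (H * g) * (H + 2 * (K + 1))"
      by (simp add: mult_ac)
    also have "\<dots> \<le> f * (H - 2) * (H + 2 * (K + 1))"
      using step HK by (intro mult_right_mono) auto
    also have "\<dots> = f * ((H - 2) * (H + 2 * (K + 1)))"
      by (simp add: mult_ac)
    also have "\<dots> \<le> f * (H * (H + 2 * K))"
      using HK by (intro mult_left_mono f0) (simp add: algebra_simps)
    also have "\<dots> = H * (f * (H + 2 * K))"
      by (simp add: mult_ac)
    finally have "g * (H + 2 * (K + 1)) \<le> f * (H + 2 * K)"
      using HK by (simp only: mult_le_cancel_left_pos)
    then show ?thesis
      using Suc.IH by (simp add: f_def g_def H_def K_def algebra_simps)
  qed (simp add: binomial_eq_0)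
qed simp


text \<open>
  The next two inequalities are stated for $u = t - 1$, where $t^2 + t - 2 = u^2 + 3u$. Both are
  proved (the first one for $u \ge 3$, where $J > 0$ is possible) by writing $u$ as its least value
  plus $s$ and $h$ as $(u^2+3u)/2 + y$: the difference of
  the two sides becomes a polynomial in $s, y \ge 0$ with positive coefficients only.
  The first one says that the shift $J$ keeps $\binom{h+J}{u}$ below $\binom{h}{u+1}$.
\<close>

lemma first_shift_polynomial:
  fixes h u J :: real
  assumes "1 \<le> u" "u\<^sup>2 + 3 * u \<le> 2 * h" "2 * u + 2 \<le> h" "J \<le> u / 3" "u < 3 \<Longrightarrow> J = 0"
  shows "(h + 1) * (u + 1) \<le> (h + 1 - J * u) * (h - u)"
proof (cases "u < 3")
  case True
  have "(h + 1) * (u + 1) \<le> (h + 1) * (h - u)"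
    using assms(1,3) by (intro mult_left_mono) auto
  then show ?thesis using True assms(5) by simp
next
  case False
  define s y where "s = u - 3" and "y = h - (u\<^sup>2 + 3 * u) / 2"
  have sy: "0 \<le> s" "0 \<le> y" using False assms by (auto simp: s_def y_def)
  have u: "u = s + 3" and h: "h = ((s + 3)\<^sup>2 + 3 * (s + 3)) / 2 + y"
    by (auto simp: s_def y_def)
  have "12 * ((h + 1 - u / 3 * u) * (h - u) - (h + 1) * (u + 1))
      = 24 + 108 * y + 12 * y^2 + 138 * s + 60 * s * y + 81 * s^2 + 8 * s^2 * y
        + 16 * s^3 + s^4"
    unfolding h unfolding u by (simp add: field_simps power2_eq_square power3_eq_cube power4_eq_xxxx)
  also have "\<dots> \<ge> 0" using sy by simp
  finally have "(h + 1) * (u + 1) \<le> (h + 1 - u / 3 * u) * (h - u)"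
    by simp
  also have "\<dots> \<le> (h + 1 - J * u) * (h - u)"
    using assms by (intro mult_right_mono diff_left_mono) auto
  finally show ?thesis .
qed

text \<open>
  This says that $h \binom{h+1}{u} \binom{h}{u+2} \le (h + 2J) \binom{h}{u+1}^2$. With $J = 0$ it
  would require $h$ to be about $u^2$; at $h \approx u^2/2$ and $u$ large it needs $J \approx cu$
  with $c > 1/4$, whereas the previous inequality tolerates $c < 1/2$. Hence the choice $c = 1/3$.
\<close>

lemma product_polynomial:
  fixes h u J :: real
  assumes "1 \<le> u" "u\<^sup>2 + 3 * u \<le> 2 * h" "u \<le> h" "(u - 2) / 3 \<le> J"
  shows "h * ((h + 1) * (u + 1) * (h - u - 1)) \<le> (h + 2 * J) * ((u + 2) * (h + 1 - u) * (h - u))"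
proof -
  define s y where "s = u - 1" and "y = h - (u\<^sup>2 + 3 * u) / 2"
  have sy: "0 \<le> s" "0 \<le> y" using assms by (auto simp: s_def y_def)
  have u: "u = s + 1" and h: "h = ((s + 1)\<^sup>2 + 3 * (s + 1)) / 2 + y"
    by (auto simp: s_def y_def)
  have "24 * ((h + 2 * ((u - 2) / 3)) * ((u + 2) * (h + 1 - u) * (h - u))
          - h * ((h + 1) * (u + 1) * (h - u - 1)))
      = 192 + 144 * y + 72 * y^2 + 24 * y^3 + 520 * s + 336 * s * y + 116 * s * y^2
        + 494 * s^2 + 210 * s^2 * y + 28 * s^2 * y^2 + 195 * s^3 + 68 * s^3 * y
        + 33 * s^4 + 10 * s^4 * y + 5 * s^5 + s^6"
    unfolding h unfolding u by (simp add: field_simps eval_nat_numeral)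
  also have "\<dots> \<ge> 0" using sy by simp
  finally have "h * ((h + 1) * (u + 1) * (h - u - 1))
      \<le> (h + 2 * ((u - 2) / 3)) * ((u + 2) * (h + 1 - u) * (h - u))"
    by simp
  also have "\<dots> \<le> (h + 2 * J) * ((u + 2) * (h + 1 - u) * (h - u))"
    using assms by (intro mult_right_mono) auto
  finally show ?thesis .
qed

text \<open>
  The maximal shift satisfying the first inequality also satisfies the second one: one step further
  the first coefficient exceeds $\binom{h}{u+1}$, while its product with the second coefficient is at
  most $\binom{h}{u+1}^2$.
\<close>

lemma balanced_shift:
  assumes "1 \<le> u" "u\<^sup>2 + 3 * u \<le> 2 * h" "2 * u + 2 \<le> h"
  obtains J where "(h + J) choose u \<le> h choose Suc u"
    and "(h - J) choose Suc (Suc u) \<le> h choose Suc u"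
proof -
  define C where "C = real (h choose Suc u)"
  \<comment> \<open>A lower bound for the maximal shift, obtained from Bernoulli's inequality.\<close>
  define J0 where "J0 = u div 3"
  define H U where "H = real h" and "U = real u"
  have uh: "1 \<le> U" "2 * U + 2 \<le> H"
    using assms(1,3) by (auto simp: H_def U_def)
  have quad: "U\<^sup>2 + 3 * U \<le> 2 * H"
    using assms(2) unfolding H_def U_def 
    by (metis (mono_tags) of_nat_add of_nat_le_iff of_nat_mult of_nat_numeral of_nat_power)
  have J0: "real J0 \<le> U / 3" "(U - 2) / 3 \<le> real J0" "U < 3 \<Longrightarrow> real J0 = 0"
  proof -
    have "3 * J0 \<le> u" "u \<le> 3 * J0 + 2" by (auto simp: J0_def)
    then have "real (3 * J0) \<le> real u" "real u \<le> real (3 * J0 + 2)"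
      by (simp_all only: of_nat_le_iff)
    then show "real J0 \<le> U / 3" "(U - 2) / 3 \<le> real J0"
      by (simp_all add: U_def)
    show "real J0 = 0" if "U < 3" using that by (simp add: J0_def U_def)
  qed
  have C: "C > 0" using assms(3) by (simp add: C_def)
  have base: "real (h choose u) = (U + 1) * C / (H - U)"
    using binomial_raise_bottom[of u h] uh assms(3) by (simp add: C_def H_def U_def field_simps)
  have J0_ok: "(h + J0) choose u \<le> h choose Suc u"
  proof -
    have poly: "(H + 1) * (U + 1) \<le> (H + 1 - real J0 * U) * (H - U)"
      using first_shift_polynomial uh quad J0 by blast
    have pos: "H + 1 - real J0 * U > 0"
      using poly uh
      by (smt (verit) mult_nonpos_nonneg mult_pos_pos)
    have "real ((h + J0) choose u) * (H + 1 - real J0 * U)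
        \<le> (H + 1) * (U + 1) * C / (H - U)"
      using binomial_raise_top_upper[of u h J0] assms(3) by (simp add: base H_def U_def)
    also have "\<dots> \<le> C * (H + 1 - real J0 * U)"
      using mult_right_mono[OF poly, of C] uh C by (simp add: field_simps)
    finally have "real ((h + J0) choose u) \<le> C"
      using pos by (simp only: mult_le_cancel_right_pos)
    then show ?thesis by (simp add: C_def)
  qed
  \<comment> \<open>The bound \<open>j \<le> h\<close> makes the maximum exist; when it is attained the second coefficient is \<open>0\<close>.\<close>
  define J where "J = (GREATEST j. j \<le> h \<and> (h + j) choose u \<le> h choose Suc u)"
  have J0h: "J0 \<le> h" using assms(3) by (simp add: J0_def)
  have J: "J \<le> h \<and> (h + J) choose u \<le> h choose Suc u"
    unfolding J_def by (rule GreatestI_nat[of _ J0 h]) (use J0_ok J0h in auto)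
  have J_max: "j \<le> J" if "j \<le> h" "(h + j) choose u \<le> h choose Suc u" for j
    unfolding J_def by (rule Greatest_le_nat[of _ j h]) (use that in auto)
  have "(h - J) choose Suc (Suc u) \<le> h choose Suc u"
  proof (cases "J = h")
    case False
    define A where "A = real ((h + J + 1) choose u)"
    define B where "B = real ((h - J) choose (u + 2))"
    have "\<not> (h + Suc J) choose u \<le> h choose Suc u"
      using J_max[of "Suc J"] J False by auto
    then have A: "A > C" by (simp add: A_def C_def)
    have J0J: "J0 \<le> J" by (rule J_max) fact+
    have top: "real ((h + 1) choose u) = (H + 1) * (U + 1) * C / ((H + 1 - U) * (H - U))"
    proof -
      have "real ((h + 1) choose u) = (H + 1) * real (h choose u) / (H + 1 - U)"
        using binomial_raise_top[of u h] uh assms(3)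
        by (simp add: H_def U_def nonzero_eq_divide_eq)
      then show ?thesis by (simp add: base mult_ac)
    qed
    have bottom: "real (h choose (u + 2)) = (H - U - 1) * C / (U + 2)"
      using binomial_raise_bottom[of "Suc u" h] uh assms(3)
      by (simp add: C_def H_def U_def field_simps)
    have "A * B * (H + 2 * real J0) \<le> A * B * (H + 2 * real J)"
      using J0J by (intro mult_left_mono) (auto simp: A_def B_def)
    also have "\<dots> \<le> H * (real ((h + 1) choose u) * real (h choose (u + 2)))"
      using binomial_product_decay[OF assms(1)] by (simp add: A_def B_def H_def)
    also have "\<dots> = H * ((H + 1) * (U + 1) * (H - U - 1)) * C\<^sup>2
        / ((U + 2) * (H + 1 - U) * (H - U))"
      unfolding top bottom by (simp add: power2_eq_square mult_ac)
    also have "\<dots> \<le> (H + 2 * real J0) * C\<^sup>2"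
    proof -
      have "H * ((H + 1) * (U + 1) * (H - U - 1))
          \<le> (H + 2 * real J0) * ((U + 2) * (H + 1 - U) * (H - U))"
        using product_polynomial[of U H] uh quad J0(2) by auto
      from mult_right_mono[OF this, of "C\<^sup>2"] show ?thesis
        using uh by (subst pos_divide_le_eq) (auto simp: mult_ac)
    qed
    finally have "A * B * (H + 2 * real J0) \<le> C\<^sup>2 * (H + 2 * real J0)"
      by (simp add: mult_ac)
    then have "A * B \<le> C\<^sup>2"
      using uh by (subst (asm) mult_le_cancel_right_pos) auto
    moreover have "C * B \<le> A * B"
      using A by (intro mult_right_mono) (auto simp: B_def)
    ultimately have "C * B \<le> C * C"
      by (simp add: power2_eq_square)
    then have "B \<le> C"
      using C by (simp only: mult_le_cancel_left_pos)
    then show ?thesis by (simp add: B_def C_def)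
  qed simp
  with J show thesis using that by blast
qed

section \<open>Comparison with the middle degree\<close>

text \<open>
  Any upper bound $\binom{a}{t}, \binom{b}{q} \le R$ with $b \le h \le a$ propagates outwards to
  $\binom{a+dJ}{t-d}, \binom{b-dJ}{q+d} \le R$, the difference being cut off at $0$. As $k + l = a + b + 1$, either $k \le a + dJ$ or
  $l \le b - dJ$.
\<close>

lemma min_binomials_le:
  assumes "1 \<le> p" and "p \<le> t" and "p + q' = t + q" and "t \<le> q"
    and "t\<^sup>2 + t \<le> 2 * h + 2" and "2 * t \<le> h" and "h \<le> a" and "b \<le> h"
    and "k + l = Suc (a + b)"
  shows "min (k choose p) (l choose q') \<le> max (a choose t) (b choose q)"
proof (cases "p = t")
  case True
  then have "k \<le> a \<or> l \<le> b" "q' = q" using assms by auto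
  then show ?thesis using True binomial_right_mono
    by (metis le_max_iff_disj min_le_iff_disj)
next
  case False
  define u where "u = t - 1"
  have u: "t = Suc u" "1 \<le> u" using assms False by (auto simp: u_def)
  have "u\<^sup>2 + 3 * u \<le> 2 * h" "2 * u + 2 \<le> h"
    using assms(5,6) by (auto simp: u power2_eq_square)
  then obtain J where J: "(h + J) choose u \<le> h choose Suc u"
    "(h - J) choose Suc t \<le> h choose t"
    using balanced_shift u by metis
  \<comment> \<open>Every step outwards uses the same shift \<open>J\<close>, transferred from the balanced point \<open>(h, t)\<close>.\<close>
  have up: "(a + d * J) choose (t - d) \<le> a choose t" if "d \<le> t" for d
    using that
  proof (induction d)
    case (Suc d)
    have "((a + d * J) + J) choose (t - Suc d) \<le> (a + d * J) choose Suc (t - Suc d)"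
      by (rule lower_bottom_transfer[OF J(1)]) (use assms u in auto)
    then show ?case
      using Suc by (simp add: Suc_diff_Suc algebra_simps)
  qed simp
  have down: "(b - d * J) choose (q + d) \<le> b choose q" for d
  proof (induction d)
    case (Suc d)
    have "((b - d * J) - J) choose Suc (q + d) \<le> (b - d * J) choose (q + d)"
      by (rule raise_bottom_transfer[OF J(2)]) (use assms in auto)
    then show ?case
      using Suc by (simp add: algebra_simps)
  qed simp
  define d where "d = t - p"
  have d: "p = t - d" "q' = q + d" "d \<le> t" using assms by (auto simp: d_def)
  have "k \<le> a + d * J \<or> l \<le> b - d * J" using assms(9) by linarith
  then show ?thesis
  proof
    assume "k \<le> a + d * J"
    then have "k choose p \<le> a choose t"
      using up[OF d(3)] binomial_right_mono[of k "a + d * J" p] d(1) by simp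
    then show ?thesis by auto
  next
    assume "l \<le> b - d * J"
    then have "l choose q' \<le> b choose q"
      using down[of d] binomial_right_mono[of l "b - d * J" q'] d(2) by simp
    then show ?thesis by auto
  qed
qed

text \<open>
  The hypothesis $n \ge m^2/4 - 1$ gives $4n + 4 \ge (2t+1)^2$, that is $n \ge t^2 + t$, and
  $n \ge 2m - 1$ gives $h \ge t + q$. The latter makes $\binom{h}{t} \le \binom{h}{q}$, so that $h$ is
  a candidate for $k^*$ and $b \le h \le k^*$.
\<close>

theorem theorem3p7:
  fixes m n :: nat
  assumes "m \<ge> 3"
    and "real n \<ge> max (2 * real m - 1) ((real m)\<^sup>2 / 4 - 1)"
  shows "can_calculate_rank m n (r_max m n) \<and>
         (\<forall>r. can_calculate_rank m n r \<longrightarrow> r \<le> r_max m n)"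
proof -
  define t where "t = p_star m"
  define q where "q = m - 1 - t"
  define h where "h = (n - 1) div 2"
  define S where "S = {k. k \<le> n - 1 \<and> (k choose t) \<le> ((n - k - 1) choose q)}"
  define K where "K = k_star m n"
  define b where "b = n - 2 - K"
  have "m = 2 * t + 1 \<or> m = 2 * t + 2"
    using assms(1) unfolding t_def p_star_def by presburger
  then have t: "1 \<le> t" "t \<le> q" "m = t + q + 1" "q = t \<or> q = Suc t"
    using assms(1) by (auto simp: q_def)
  have q_eq: "m - t - 1 = q" by (simp add: t(3))
  have n_lin: "2 * m \<le> n + 1"
    using assms(2) by simp
  have "real (m\<^sup>2) \<le> real (4 * n + 4)"
    using assms(2) by simp
  then have n_quad: "m\<^sup>2 \<le> 4 * n + 4"
    by (simp only: of_nat_le_iff)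
  have "4 * (t\<^sup>2 + t) + 1 = (2 * t + 1)\<^sup>2"
    by (simp add: power2_eq_square)
  also have "\<dots> \<le> m\<^sup>2"
    using t by (intro power_mono) auto
  also note n_quad
  finally have "t\<^sup>2 + t \<le> n" by presburger
  then have h: "t\<^sup>2 + t \<le> 2 * h + 2" "2 * t \<le> h" "t + q \<le> h" "2 * h + 1 \<le> n" "n \<le> 2 * h + 2"
    using n_lin t by (auto simp: h_def)
  have "k_star m n = Max S"
    using t(3) by (simp add: k_star_def S_def t_def q_def diff_commute)
  then have K: "K = Max S" by (simp add: K_def)
  have fin: "finite S" by (simp add: S_def)
  have "h choose t \<le> h choose q"
  proof (cases "q = t")
    case False
    then have q: "q = Suc t" using t(4) by simp
    have "Suc t * (h choose t) \<le> (h - t) * (h choose t)"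
      using h(3) q by (intro mult_right_mono) auto
    also have "\<dots> = Suc t * (h choose Suc t)"
      by (simp only: binomial_absorption binomial_absorb_comp)
    finally show ?thesis using q by (simp only: Suc_mult_le_cancel1)
  qed simp
  also have "\<dots> \<le> (n - h - 1) choose q"
    using h by (intro binomial_right_mono) auto
  finally have hS: "h \<in> S" using h by (simp add: S_def)
  then have KS: "K \<in> S" and hK: "h \<le> K"
    unfolding K using fin Max_in[of S] Max_ge[of S h] by blast+
  have pos: "0 < K choose t" using hK h by auto
  have "K choose t \<le> (n - K - 1) choose q" using KS by (simp add: S_def)
  with pos have "0 < (n - K - 1) choose q" by (rule less_le_trans)
  then have Kq: "q \<le> n - K - 1" by (simp only: zero_less_binomial_iff)
  then have Kb: "K + b + 2 = n" and b: "b \<le> h"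
    using t h hK by (auto simp: b_def)
  have r: "r_max m n = max (K choose t) (b choose q)"
    by (simp add: r_max_def K_def b_def t_def q_def)
  \<comment> \<open>The maximum is attained at \<open>K\<close> if its first entry is the larger one, otherwise at \<open>K + 1\<close>.\<close>
  have "can_calculate_rank m n (r_max m n)"
  proof (cases "b choose q \<le> K choose t")
    case True
    have "r_max m n \<le> min (K choose t) ((n - K - 1) choose (m - t - 1))"
      unfolding r q_eq using True KS by (simp add: S_def)
    then show ?thesis
      unfolding can_calculate_rank_def using t h hK Kq
      by (intro exI[of _ t] exI[of _ K]) auto
  next
    case False
    have "Suc K \<notin> S" by (metis K Max_ge Suc_n_not_le_n fin)
    moreover have "Suc K \<le> n - 1" "n - Suc K - 1 = b" using Kb by auto
    ultimately have "b choose q \<le> Suc K choose t" by (auto simp: S_def)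
    then have "r_max m n \<le> min (Suc K choose t) ((n - Suc K - 1) choose (m - t - 1))"
      unfolding r q_eq using False by (simp add: b_def)
    moreover have "q \<le> b"
      using False pos by (metis binomial_eq_0 not_le zero_le)
    ultimately show ?thesis
      unfolding can_calculate_rank_def using t h hK Kb
      by (intro exI[of _ t] exI[of _ "Suc K"]) auto
  qed
  moreover have "r \<le> r_max m n" if calc: "can_calculate_rank m n r" for r
  proof -
    obtain p k where p: "1 \<le> p" "p + 2 \<le> m" "p \<le> k" "k + m \<le> n + p"
      and rle: "r \<le> min (k choose p) ((n - k - 1) choose (m - p - 1))"
      using calc by (auto simp: can_calculate_rank_def)
    define q' l where "q' = m - p - 1" and "l = n - k - 1"
    have q': "1 \<le> q'" "p + q' = t + q" and l: "k + l = Suc (K + b)"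
      using p t Kb by (auto simp: q'_def l_def)
    have "min (k choose p) (l choose q') \<le> max (K choose t) (b choose q)"
    proof (cases "p \<le> t")
      case True
      then show ?thesis
        using min_binomials_le[of p t q' q h K b k l] p q' t h hK b l by blast
    next
      case False
      then have "q' \<le> t" using q'(2) t(4) by auto
      then show ?thesis
        using min_binomials_le[of q' t p q h K b l k] p q' t h hK b l
        by (simp add: min.commute add.commute)
    qed
    then show ?thesis using rle unfolding r q'_def l_def by (rule order_trans[rotated])
  qed
  ultimately show ?thesis by blast
qed

end
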